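(* Let $t>0$, let $i_1<\dots<i_M$ be real, let $\underline b=(b_2,\dots,b_{M-1})$ satisfy $-\frac{1}{i_{j+1}-i_j}<b_j<\frac{1}{i_j-i_{j-1}}$ for $j=2,\dots,M-1$, and let $\underline k=(k_2,\dots,k_{M-1})\in\mathbb R_+^{M-2}$. For a given $\underline p\in\mathbb S^M$ there exists $(\mathcal G_1,\dots,\mathcal G_M)\in\{0\}\times\mathbb R_+^{M-2}\times\{0\}$ satisfying $$\mathcal G_j=\frac{1}{tp_j}\frac{\kappa_{j+1}-\kappa_{j-1}}{(\kappa_{j+1}-\kappa_j)(\kappa_j-\kappa_{j-1})}\times\begin{cases}\sum_{a=1}^{j-1}(\kappa_j-\kappa_a)p_a(1+t\mathcal G_a\widetilde k_a)&2\le j\le l-1\\ \sum_{a=j+1}^{M}(\kappa_a-\kappa_j)p_a(1+t\mathcal G_a\widetilde k_a)&l\le j\le M-1\end{cases}$$ for $2\le j\le M-1$, where $l\in\{2,\dots,M\}$ is such that $$\kappa_{l-1}<\frac{\sum_{j=1}^M\kappa_jp_j(1+t\mathcal G_j\widetilde k_j)}{\sum_{j=1}^Mp_j(1+t\mathcal G_j\widetilde k_j)}\le\kappa_l .$$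
   Context: Conventions: $\mathbb R_+=[0,\infty)$, $M\ge3$, $\mathbb S^M=\{(p_1,\dots,p_M):0<p_j<1,\ \sum_jp_j=1\}$. Set $\widetilde k_j=(i_{j+1}-i_j)(i_j-i_{j-1})k_j$ for $2\le j\le M-1$, $\widetilde k_1=\widetilde k_M=0$. Coordinate change $\underline\kappa=(\kappa_1,\dots,\kappa_M)$: let $\delta_j=i_j-i_{j-1}$ ($2\le j\le M$); $\Pi_1=1$, $\Pi_j=\prod_{n=2}^j\frac{1-\delta_nb_n}{1+\delta_{n+1}b_n}$ ($2\le j\le M-1$). Fix $\vartheta\in(0,\frac12)$ with $e_-:=\inf\{j:\sum_{i=1}^jp_i\ge\vartheta\}<e_+:=\sup\{j:\sum_{i=j}^Mp_i\ge\vartheta\}$, let $K=(i_{e_+}-i_{e_-})\vee1$, $\epsilon_{j+1}=K\,\delta_{j+1}\Pi_j\big/\sum_{a=e_-}^{e_+-1}\delta_{a+1}\Pi_a$ ($1\le j\le M-1$). Let $e$ satisfy $\sum_{i\le e}p_i\ge\frac12$, $\sum_{i\ge e}p_i\ge\frac12$. Then $\underline\kappa$ is defined by $\kappa_e=0$ and $\kappa_j-\kappa_{j-1}=\epsilon_j$ for $2\le j\le M$; in particular it is strictly increasing. *)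

theory Defs
  imports Complex_Main
begin

text \<open>All tuples are functions on \<^typ>\<open>nat\<close>, used only at the indices \<open>1, \<dots>, M\<close>
  (resp. \<open>2, \<dots>, M - 1\<close>).\<close>

definition k_tilde :: "nat \<Rightarrow> (nat \<Rightarrow> real) \<Rightarrow> (nat \<Rightarrow> real) \<Rightarrow> nat \<Rightarrow> real" where
  "k_tilde M i k j =
     (if 2 \<le> j \<and> j \<le> M - 1 then (i (j + 1) - i j) * (i j - i (j - 1)) * k j else 0)"

definition gap :: "(nat \<Rightarrow> real) \<Rightarrow> nat \<Rightarrow> real" where
  "gap i j = i j - i (j - 1)"

text \<open>At \<open>j = 1\<close> the product below is empty, which is the convention \<open>\<Pi>\<^sub>1 = 1\<close>.\<close>

definition Pi_prod :: "(nat \<Rightarrow> real) \<Rightarrow> (nat \<Rightarrow> real) \<Rightarrow> nat \<Rightarrow> real" where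
  "Pi_prod i b j = (\<Prod>n=2..j. (1 - gap i n * b n) / (1 + gap i (n + 1) * b n))"

text \<open>Both sets below are nonempty for \<open>0 < \<theta> < 1/2\<close> and \<open>p\<close> a probability vector on
  \<open>{1..M}\<close>, so \<^const>\<open>Inf\<close> and \<^const>\<open>Sup\<close> are a genuine minimum and maximum.\<close>

definition e_minus :: "nat \<Rightarrow> (nat \<Rightarrow> real) \<Rightarrow> real \<Rightarrow> nat" where
  "e_minus M p \<theta> = Inf {j \<in> {1..M}. (\<Sum>n=1..j. p n) \<ge> \<theta>}"

definition e_plus :: "nat \<Rightarrow> (nat \<Rightarrow> real) \<Rightarrow> real \<Rightarrow> nat" where
  "e_plus M p \<theta> = Sup {j \<in> {1..M}. (\<Sum>n=j..M. p n) \<ge> \<theta>}"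

definition K_const :: "nat \<Rightarrow> (nat \<Rightarrow> real) \<Rightarrow> (nat \<Rightarrow> real) \<Rightarrow> real \<Rightarrow> real" where
  "K_const M i p \<theta> = max (i (e_plus M p \<theta>) - i (e_minus M p \<theta>)) 1"

definition eps ::
  "nat \<Rightarrow> (nat \<Rightarrow> real) \<Rightarrow> (nat \<Rightarrow> real) \<Rightarrow> (nat \<Rightarrow> real) \<Rightarrow> real \<Rightarrow> nat \<Rightarrow> real" where
  "eps M i b p \<theta> j =
     K_const M i p \<theta> * gap i j * Pi_prod i b (j - 1) /
       (\<Sum>a = e_minus M p \<theta> ..< e_plus M p \<theta>. gap i (a + 1) * Pi_prod i b a)"

end

theory Submission
  imports Defs
begin

text \<open>With \<open>w a = p a * (1 + t * G a * k_tilde M i k a)\<close>, the equations for \<open>j < l\<close> form a forward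
  recursion started at \<open>1\<close> and those for \<open>j \<ge> l\<close> a backward recursion started at \<open>M\<close>. Neither
  recursion mentions \<open>l\<close>, so each is solved once and for all, giving positive weights \<open>u\<close> and
  \<open>v\<close>; a choice of \<open>l\<close> only decides where to switch from \<open>u\<close> to \<open>v\<close>. Put
  \<open>A j = (\<Sum>a<j. (\<kappa> j - \<kappa> a) * u a)\<close> and \<open>B j = (\<Sum>a>j. (\<kappa> a - \<kappa> j) * v a)\<close>. For the weights
  switched at \<open>l\<close>, the barycentre exceeds \<open>\<kappa> (l - 1)\<close> iff \<open>A (l - 1) < B (l - 1)\<close>, and is at most
  \<open>\<kappa> l\<close> iff \<open>B l \<le> A l\<close>. As \<open>A 1 = 0 < B 1\<close> and \<open>B M = 0 \<le> A M\<close>, the least \<open>l\<close> with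
  \<open>B l \<le> A l\<close> works.\<close>

section \<open>The two recursions and their signs\<close>

function forward_solution ::
  "(nat \<Rightarrow> real) \<Rightarrow> (nat \<Rightarrow> real) \<Rightarrow> (nat \<Rightarrow> real) \<Rightarrow> (nat \<Rightarrow> real) \<Rightarrow> nat \<Rightarrow> real" where
  "forward_solution c x p q j =
     c j * (\<Sum>a=1..j-1. (x j - x a) * p a * (1 + forward_solution c x p q a * q a))"
  by auto
termination
  by (relation "measure (\<lambda>(_, _, _, _, j). j)") auto

function backward_solution ::
  "nat \<Rightarrow> (nat \<Rightarrow> real) \<Rightarrow> (nat \<Rightarrow> real) \<Rightarrow> (nat \<Rightarrow> real) \<Rightarrow> (nat \<Rightarrow> real) \<Rightarrow> nat \<Rightarrow> real" where
  "backward_solution M c x p q j =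
     c j * (\<Sum>a=j+1..M. (x a - x j) * p a * (1 + backward_solution M c x p q a * q a))"
  by auto
termination
  by (relation "measure (\<lambda>(M, _, _, _, _, j). M - j)") auto

text \<open>Both equations are unconditional and mention the function again on the right, so simp
  would unfold them forever.\<close>

declare forward_solution.simps [simp del] backward_solution.simps [simp del]

text \<open>Nonnegativity passes from the earlier values to each new one; it is what makes the
  weights \<open>p a * (1 + G a * q a)\<close> positive.\<close>

lemma forward_solution_nonneg:
  assumes "strict_mono_on {1..M} x"
    and "\<And>a. a \<in> {1..M} \<Longrightarrow> 0 \<le> c a" "\<And>a. a \<in> {1..M} \<Longrightarrow> 0 \<le> p a"
    and "\<And>a. a \<in> {1..M} \<Longrightarrow> 0 \<le> q a"
    and "j \<in> {1..M}"
  shows "0 \<le> forward_solution c x p q j"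
  using assms(5)
proof (induction j rule: less_induct)
  case (less j)
  have "0 \<le> (x j - x a) * p a * (1 + forward_solution c x p q a * q a)" if "a \<in> {1..j-1}" for a
  proof -
    have a: "a \<in> {1..M}" "a < j" using that less.prems by auto
    then have "x a < x j" using strict_mono_onD[OF assms(1)] less.prems by blast
    then show ?thesis using less.IH[OF a(2,1)] assms(3,4)[OF a(1)] by simp
  qed
  then show ?case
    unfolding forward_solution.simps[of c x p q j]
    using assms(2)[OF less.prems] by (blast intro: mult_nonneg_nonneg[OF _ sum_nonneg])
qed

lemma backward_solution_nonneg:
  assumes "strict_mono_on {1..M} x"
    and "\<And>a. a \<in> {1..M} \<Longrightarrow> 0 \<le> c a" "\<And>a. a \<in> {1..M} \<Longrightarrow> 0 \<le> p a"
    and "\<And>a. a \<in> {1..M} \<Longrightarrow> 0 \<le> q a"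
    and "j \<in> {1..M}"
  shows "0 \<le> backward_solution M c x p q j"
  using assms(5)
proof (induction "M - j" arbitrary: j rule: less_induct)
  case less
  have "0 \<le> (x a - x j) * p a * (1 + backward_solution M c x p q a * q a)" if "a \<in> {j+1..M}" for a
  proof -
    have a: "M - a < M - j" "a \<in> {1..M}" "j < a" using that less.prems by auto
    then have "x j < x a" using strict_mono_onD[OF assms(1)] less.prems by blast
    then show ?thesis using less.hyps[OF a(1,2)] assms(3,4)[OF a(2)] by simp
  qed
  then show ?case
    unfolding backward_solution.simps[of M c x p q j]
    using assms(2)[OF less.prems] by (blast intro: mult_nonneg_nonneg[OF _ sum_nonneg])
qed

section \<open>Choosing the switching index\<close>

text \<open>For positive total weight, the left side has the sign of barycentre minus
  \<open>x m\<close>. The term at \<open>m\<close> vanishes, so the weight \<open>w m\<close> does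
  not enter the right side.\<close>

lemma sum_moment_about_point:
  fixes x w :: "nat \<Rightarrow> real"
  assumes "m \<in> {1..M}"
  shows "(\<Sum>j=1..M. x j * w j) - x m * (\<Sum>j=1..M. w j) =
    (\<Sum>a=m+1..M. (x a - x m) * w a) - (\<Sum>a=1..m-1. (x m - x a) * w a)"
proof -
  have "{1..M} = {1..m-1} \<union> {m} \<union> {m+1..M}" using assms by auto
  then have "(\<Sum>a=1..M. (x a - x m) * w a) =
      (\<Sum>a\<in>{1..m-1} \<union> {m} \<union> {m+1..M}. (x a - x m) * w a)" by simp
  also have "\<dots> = (\<Sum>a=1..m-1. (x a - x m) * w a) + (\<Sum>a=m+1..M. (x a - x m) * w a)"
    using assms by (subst sum.union_disjoint; auto)+
  also have "(\<Sum>a=1..m-1. (x a - x m) * w a) = - (\<Sum>a=1..m-1. (x m - x a) * w a)"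
    unfolding sum_negf[symmetric] by (intro sum.cong) (auto simp: algebra_simps)
  finally show ?thesis
    by (simp add: sum_distrib_left sum_subtractf left_diff_distrib)
qed

text \<open>The index \<open>l\<close> is fixed by \<open>u\<close> and \<open>v\<close> alone,
  before any \<open>w\<close> is given. This breaks the apparent circularity of an \<open>l\<close>
  that depends on the solution.\<close>

lemma barycentre_switch:
  fixes x u v :: "nat \<Rightarrow> real"
  assumes "M \<ge> 2" and x: "strict_mono_on {1..M} x"
    and u: "\<And>j. j \<in> {1..M} \<Longrightarrow> 0 < u j" and v: "\<And>j. j \<in> {1..M} \<Longrightarrow> 0 < v j"
  obtains l where "l \<in> {2..M}"
    "\<And>w. (\<And>j. j \<in> {1..<l} \<Longrightarrow> w j = u j) \<Longrightarrow> (\<And>j. j \<in> {l..M} \<Longrightarrow> w j = v j) \<Longrightarrow>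
      x (l - 1) < (\<Sum>j=1..M. x j * w j) / (\<Sum>j=1..M. w j) \<and>
      (\<Sum>j=1..M. x j * w j) / (\<Sum>j=1..M. w j) \<le> x l"
proof -
  define A where "A j = (\<Sum>a=1..j-1. (x j - x a) * u a)" for j
  define B where "B j = (\<Sum>a=j+1..M. (x a - x j) * v a)" for j
  define l where "l = (LEAST j. 1 \<le> j \<and> B j \<le> A j)"
  have less: "x a < x b" if "a \<in> {1..M}" "b \<in> {1..M}" "a < b" for a b
    using strict_mono_onD[OF x] that by blast
  have "0 \<le> A M"
    unfolding A_def using \<open>M \<ge> 2\<close>
    by (intro sum_nonneg mult_nonneg_nonneg) (auto intro!: less_imp_le less u)
  then have M: "1 \<le> M \<and> B M \<le> A M" using \<open>M \<ge> 2\<close> by (simp add: B_def)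
  have l: "1 \<le> l" "B l \<le> A l" and "l \<le> M"
    using LeastI[of "\<lambda>j. 1 \<le> j \<and> B j \<le> A j", OF M]
      Least_le[of "\<lambda>j. 1 \<le> j \<and> B j \<le> A j", OF M] by (auto simp: l_def)
  have "0 < B 1"
    unfolding B_def using \<open>M \<ge> 2\<close>
    by (intro sum_pos mult_pos_pos) (auto intro!: less v)
  then have "l \<noteq> 1" using l by (auto simp: A_def)
  then have l2: "l \<in> {2..M}" using l \<open>l \<le> M\<close> by auto
  \<comment> \<open>Since \<open>l \<ge> 2\<close>, the index \<open>l - 1\<close> still satisfies
    \<open>1 \<le> l - 1\<close>, so minimality can only fail it on the inequality.\<close>
  then have below: "A (l - 1) < B (l - 1)"
    using not_less_Least[of "l - 1" "\<lambda>j. 1 \<le> j \<and> B j \<le> A j", folded l_def] by auto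
  show thesis
  proof (rule that[OF l2])
    fix w assume wu: "\<And>j. j \<in> {1..<l} \<Longrightarrow> w j = u j" and wv: "\<And>j. j \<in> {l..M} \<Longrightarrow> w j = v j"
    have "0 < w j" if "j \<in> {1..M}" for j
      using u v wu wv that by (cases "j < l") auto
    then have pos: "0 < (\<Sum>j=1..M. w j)" using \<open>M \<ge> 2\<close> by (intro sum_pos) auto
    \<comment> \<open>About \<open>l - 1\<close>, and likewise about \<open>l\<close>, the lower sum
      uses only indices below \<open>l\<close>, where \<open>w\<close> is \<open>u\<close>, and the
      upper sum only indices from \<open>l\<close> on, where \<open>w\<close> is
      \<open>v\<close>.\<close>
    have "(\<Sum>j=1..M. x j * w j) - x (l-1) * (\<Sum>j=1..M. w j) = B (l-1) - A (l-1)"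
      unfolding A_def B_def using l2
      by (subst sum_moment_about_point) (auto intro!: arg_cong2[of _ _ _ _ minus] sum.cong simp: wu wv)
    moreover have "(\<Sum>j=1..M. x j * w j) - x l * (\<Sum>j=1..M. w j) = B l - A l"
      unfolding A_def B_def using l2
      by (subst sum_moment_about_point) (auto intro!: arg_cong2[of _ _ _ _ minus] sum.cong simp: wu wv)
    ultimately show "x (l - 1) < (\<Sum>j=1..M. x j * w j) / (\<Sum>j=1..M. w j) \<and>
      (\<Sum>j=1..M. x j * w j) / (\<Sum>j=1..M. w j) \<le> x l"
      using pos below l(2) by (simp add: pos_less_divide_eq pos_divide_le_eq)
  qed
qed

text \<open>Only the signs of \<open>c\<close> and \<open>q\<close> matter for solvability, so both
  are kept arbitrary here.\<close>

lemma coupled_recursion_solvable: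
  fixes x p c q :: "nat \<Rightarrow> real"
  assumes "M \<ge> 2" and x: "strict_mono_on {1..M} x"
    and p: "\<And>j. j \<in> {1..M} \<Longrightarrow> 0 < p j"
    and c: "\<And>j. j \<in> {1..M} \<Longrightarrow> 0 \<le> c j" and q: "\<And>j. j \<in> {1..M} \<Longrightarrow> 0 \<le> q j"
  obtains G l where "l \<in> {2..M}" "G 1 = 0" "G M = 0" "\<And>j. j \<in> {1..M} \<Longrightarrow> 0 \<le> G j"
    "x (l - 1) < (\<Sum>j=1..M. x j * (p j * (1 + G j * q j))) / (\<Sum>j=1..M. p j * (1 + G j * q j))"
    "(\<Sum>j=1..M. x j * (p j * (1 + G j * q j))) / (\<Sum>j=1..M. p j * (1 + G j * q j)) \<le> x l"
    "\<And>j. j \<in> {1..M} \<Longrightarrow> G j = c j *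
      (if j \<le> l - 1 then \<Sum>a=1..j-1. (x j - x a) * p a * (1 + G a * q a)
       else \<Sum>a=j+1..M. (x a - x j) * p a * (1 + G a * q a))"
proof -
  define F where "F = forward_solution c x p q"
  define H where "H = backward_solution M c x p q"
  have F: "0 \<le> F j" and H: "0 \<le> H j" if "j \<in> {1..M}" for j
    using forward_solution_nonneg[OF x c less_imp_le[OF p] q that]
      backward_solution_nonneg[OF x c less_imp_le[OF p] q that] by (auto simp: F_def H_def)
  have pos: "0 < p j * (1 + F j * q j)" "0 < p j * (1 + H j * q j)" if "j \<in> {1..M}" for j
    using p[OF that] q[OF that] F[OF that] H[OF that]
    by (intro mult_pos_pos add_pos_nonneg mult_nonneg_nonneg; simp)+
  obtain l where l: "l \<in> {2..M}" and bary:
    "\<And>w. (\<And>j. j \<in> {1..<l} \<Longrightarrow> w j = p j * (1 + F j * q j)) \<Longrightarrow>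
      (\<And>j. j \<in> {l..M} \<Longrightarrow> w j = p j * (1 + H j * q j)) \<Longrightarrow>
      x (l - 1) < (\<Sum>j=1..M. x j * w j) / (\<Sum>j=1..M. w j) \<and>
      (\<Sum>j=1..M. x j * w j) / (\<Sum>j=1..M. w j) \<le> x l"
    using barycentre_switch[OF \<open>M \<ge> 2\<close> x, of "\<lambda>j. p j * (1 + F j * q j)"
        "\<lambda>j. p j * (1 + H j * q j)"] pos by blast
  define G where "G j = (if j < l then F j else H j)" for j
  have "G j = c j *
      (if j \<le> l - 1 then \<Sum>a=1..j-1. (x j - x a) * p a * (1 + G a * q a)
       else \<Sum>a=j+1..M. (x a - x j) * p a * (1 + G a * q a))" if "j \<in> {1..M}" for j
  proof (cases "j < l")
    case True
    have "F j = c j * (\<Sum>a=1..j-1. (x j - x a) * p a * (1 + F a * q a))"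
      unfolding F_def by (rule forward_solution.simps)
    \<comment> \<open>The forward equation at \<open>j < l\<close> refers only to smaller indices,
      where \<open>G\<close> is still \<open>F\<close>; the backward case is symmetric.\<close>
    also have "(\<Sum>a=1..j-1. (x j - x a) * p a * (1 + F a * q a)) =
        (\<Sum>a=1..j-1. (x j - x a) * p a * (1 + G a * q a))"
      using True by (intro sum.cong) (auto simp: G_def)
    finally show ?thesis using True by (auto simp: G_def)
  next
    case False
    have "H j = c j * (\<Sum>a=j+1..M. (x a - x j) * p a * (1 + H a * q a))"
      unfolding H_def by (rule backward_solution.simps)
    also have "(\<Sum>a=j+1..M. (x a - x j) * p a * (1 + H a * q a)) =
        (\<Sum>a=j+1..M. (x a - x j) * p a * (1 + G a * q a))"
      using False by (intro sum.cong) (auto simp: G_def)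
    finally show ?thesis using False l by (auto simp: G_def)
  qed
  \<comment> \<open>As \<open>2 \<le> l \<le> M\<close>, index \<open>1\<close> falls in the forward
    branch and \<open>M\<close> in the backward one, and there the sums are empty.\<close>
  moreover have "G 1 = 0" "G M = 0"
    using l by (auto simp: G_def F_def H_def forward_solution.simps[of _ _ _ _ 1]
      forward_solution.simps[of _ _ _ _ "Suc 0"] backward_solution.simps[of M _ _ _ _ M])
  moreover have "0 \<le> G j" if "j \<in> {1..M}" for j
    using F[OF that] H[OF that] by (simp add: G_def)
  ultimately show thesis
    using bary[of "\<lambda>j. p j * (1 + G j * q j)"] l by (intro that[of l G]) (auto simp: G_def)
qed

section \<open>Positivity of the increments of \<kappa>\<close>

text \<open>The two bounds on \<open>b n\<close> amount to positivity of the numerator and the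
  denominator of the factor at \<open>n\<close>.\<close>

lemma Pi_prod_pos:
  assumes i: "strict_mono_on {1..M} i"
    and b: "\<forall>j\<in>{2..M-1}. - 1 / (i (j + 1) - i j) < b j \<and> b j < 1 / (i j - i (j - 1))"
    and "j \<le> M - 1"
  shows "0 < Pi_prod i b j"
  unfolding Pi_prod_def
proof (intro prod_pos ballI divide_pos_pos)
  fix n assume n: "n \<in> {2..j}"
  then have "n \<in> {2..M-1}" using assms(3) by auto
  note bn = bspec[OF b this]
  have "i (n - 1) < i n" "i n < i (n + 1)"
    using n assms(3) by (auto intro!: strict_mono_onD[OF i])
  then show "0 < 1 - gap i n * b n" "0 < 1 + gap i (n + 1) * b n"
    using bn by (auto simp: gap_def field_simps)
qed

text \<open>The total mass reaches \<theta>, so the set contains \<open>M\<close> and its infimum is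
  attained. With \<open>e_plus_le\<close> this keeps the denominator of \<open>eps\<close> within
  indices where gaps and products are positive.\<close>

lemma e_minus_ge_1:
  assumes "1 \<le> M" "(\<Sum>j=1..M. p j) \<ge> \<theta>"
  shows "1 \<le> e_minus M p \<theta>"
proof -
  have "M \<in> {j \<in> {1..M}. (\<Sum>n=1..j. p n) \<ge> \<theta>}" using assms by auto
  then have "Inf {j \<in> {1..M}. (\<Sum>n=1..j. p n) \<ge> \<theta>} \<in> {j \<in> {1..M}. (\<Sum>n=1..j. p n) \<ge> \<theta>}"
    by (intro Inf_nat_def1) auto
  then show ?thesis by (simp add: e_minus_def)
qed

lemma e_plus_le:
  assumes "1 \<le> M" "(\<Sum>j=1..M. p j) \<ge> \<theta>"
  shows "e_plus M p \<theta> \<le> M"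
proof -
  have "1 \<in> {j \<in> {1..M}. (\<Sum>n=j..M. p n) \<ge> \<theta>}" using assms by auto
  then show ?thesis unfolding e_plus_def by (intro cSup_least) auto
qed

text \<open>Strictness of \<open>e_minus < e_plus\<close> makes the denominator a nonempty sum of
  positive terms, and the maximum with \<open>1\<close> makes \<open>K_const\<close>
  positive.\<close>

lemma eps_pos:
  assumes i: "strict_mono_on {1..M} i"
    and b: "\<forall>j\<in>{2..M-1}. - 1 / (i (j + 1) - i j) < b j \<and> b j < 1 / (i j - i (j - 1))"
    and "(\<Sum>j=1..M. p j) \<ge> \<theta>"
    and e: "e_minus M p \<theta> < e_plus M p \<theta>"
    and j: "j \<in> {2..M}"
  shows "0 < eps M i b p \<theta> j"
proof -
  have gap: "0 < gap i n" if "n \<in> {2..M}" for n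
    using strict_mono_onD[OF i, of "n - 1" n] that by (auto simp: gap_def)
  have em: "1 \<le> e_minus M p \<theta>" and ep: "e_plus M p \<theta> \<le> M"
    using e_minus_ge_1 e_plus_le assms(3) j by auto
  have "0 < gap i (a + 1) * Pi_prod i b a" if "a \<in> {e_minus M p \<theta> ..< e_plus M p \<theta>}" for a
    using that em ep by (intro mult_pos_pos gap Pi_prod_pos[OF i b]) auto
  then have "0 < (\<Sum>a = e_minus M p \<theta> ..< e_plus M p \<theta>. gap i (a + 1) * Pi_prod i b a)"
    using e by (intro sum_pos) auto
  moreover have "0 < Pi_prod i b (j - 1)" using j by (intro Pi_prod_pos[OF i b]) auto
  moreover have "0 < K_const M i p \<theta>" by (simp add: K_const_def)
  ultimately show ?thesis unfolding eps_def using gap[OF j] by simp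
qed

lemma strict_mono_on_atLeastAtMost_stepI:
  fixes x :: "nat \<Rightarrow> real"
  assumes "\<And>j. j \<in> {Suc m..M} \<Longrightarrow> x (j - 1) < x j"
  shows "strict_mono_on {m..M} x"
proof (rule strict_mono_onI)
  fix r s assume r: "r \<in> {m..M}" and s: "s \<in> {m..M}" and "r < s"
  have "Suc r \<le> s" using \<open>r < s\<close> by simp
  then show "x r < x s" using s
  proof (induction s rule: dec_induct)
    case base
    then show ?case using assms[of "Suc r"] r by simp
  next
    case (step n)
    then show ?case using assms[of "Suc n"] r by fastforce
  qed
qed

section \<open>Application to the coordinates \<kappa>\<close>

theorem lemma4p1:
  fixes M e :: nat and t \<theta> :: real and i b k p \<kappa> :: "nat \<Rightarrow> real"
  assumes "M \<ge> 3"
    and "t > 0"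
    and "strict_mono_on {1..M} i"
    and "\<forall>j\<in>{2..M-1}. - 1 / (i (j + 1) - i j) < b j \<and> b j < 1 / (i j - i (j - 1))"
    and "\<forall>j\<in>{2..M-1}. k j \<ge> 0"
    and "\<forall>j\<in>{1..M}. 0 < p j \<and> p j < 1"
    and "(\<Sum>j=1..M. p j) = 1"
    and "0 < \<theta>" and "\<theta> < 1 / 2"
    and "e_minus M p \<theta> < e_plus M p \<theta>"
    and "e \<in> {1..M}"
    and "(\<Sum>j=1..e. p j) \<ge> 1 / 2"
    and "(\<Sum>j=e..M. p j) \<ge> 1 / 2"
    and "\<kappa> e = 0"
    and "\<forall>j\<in>{2..M}. \<kappa> j - \<kappa> (j - 1) = eps M i b p \<theta> j"
  shows "\<exists>G :: nat \<Rightarrow> real.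
      G 1 = 0 \<and> G M = 0 \<and> (\<forall>j\<in>{2..M-1}. G j \<ge> 0) \<and>
      (\<exists>l\<in>{2..M}.
         \<kappa> (l - 1) < (\<Sum>j=1..M. \<kappa> j * p j * (1 + t * G j * k_tilde M i k j)) /
                      (\<Sum>j=1..M. p j * (1 + t * G j * k_tilde M i k j)) \<and>
         (\<Sum>j=1..M. \<kappa> j * p j * (1 + t * G j * k_tilde M i k j)) /
           (\<Sum>j=1..M. p j * (1 + t * G j * k_tilde M i k j)) \<le> \<kappa> l \<and>
         (\<forall>j\<in>{2..M-1}.
            G j = 1 / (t * p j) *
              ((\<kappa> (j + 1) - \<kappa> (j - 1)) / ((\<kappa> (j + 1) - \<kappa> j) * (\<kappa> j - \<kappa> (j - 1)))) *
              (if j \<le> l - 1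
               then \<Sum>a=1..j-1. (\<kappa> j - \<kappa> a) * p a * (1 + t * G a * k_tilde M i k a)
               else \<Sum>a=j+1..M. (\<kappa> a - \<kappa> j) * p a * (1 + t * G a * k_tilde M i k a))))"
proof -
  define c where "c j = (\<kappa> (j + 1) - \<kappa> (j - 1)) / ((\<kappa> (j + 1) - \<kappa> j) * (\<kappa> j - \<kappa> (j - 1)))" for j
  \<comment> \<open>The coefficient is cut off at \<open>1\<close> and \<open>M\<close>, where it would involve \<open>\<kappa> 0\<close> and \<open>\<kappa> (M + 1)\<close>.\<close>
  define d where "d j = (if j \<in> {2..M-1} then 1 / (t * p j) * c j else 0)" for j
  have i: "i (j - 1) < i j" if "j \<in> {2..M}" for j
    using strict_mono_onD[OF assms(3), of "j - 1" j] that by auto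
  \<comment> \<open>Total mass \<open>1\<close> exceeds \<theta>, as \<open>eps_pos\<close>
    requires.\<close>
  have step: "\<kappa> (j - 1) < \<kappa> j" if "j \<in> {2..M}" for j
    using bspec[OF assms(15) that] eps_pos[OF assms(3,4) _ assms(10) that] assms(7,9) by simp
  have mono: "strict_mono_on {1..M} \<kappa>"
    by (rule strict_mono_on_atLeastAtMost_stepI) (use step in auto)
  have p: "0 < p j" if "j \<in> {1..M}" for j using assms(6) that by auto
  have d: "0 \<le> d j" if "j \<in> {1..M}" for j
  proof (cases "j \<in> {2..M-1}")
    case True
    then have "\<kappa> (j - 1) < \<kappa> j" "\<kappa> j < \<kappa> (j + 1)" using step[of j] step[of "j + 1"] by auto
    then have "0 \<le> c j" unfolding c_def by (intro divide_nonneg_pos mult_pos_pos) auto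
    then show ?thesis using p[OF that] assms(2) by (simp add: d_def)
  qed (auto simp: d_def)
  have q: "0 \<le> t * k_tilde M i k j" if "j \<in> {1..M}" for j
  proof (cases "j \<in> {2..M-1}")
    case True
    then have "i (j - 1) < i j" "i j < i (j + 1)" "0 \<le> k j"
      using i[of j] i[of "j + 1"] assms(5) by auto
    then show ?thesis using assms(2) by (simp add: k_tilde_def)
  qed (auto simp: k_tilde_def)
  \<comment> \<open>The general recursion is used with coefficients \<open>d\<close> and with
    \<open>t\<close> absorbed into \<open>q\<close>; \<open>comm\<close> below restores the stated
    order of factors.\<close>
  obtain G l where G: "l \<in> {2..M}" "G 1 = 0" "G M = 0" "\<And>j. j \<in> {1..M} \<Longrightarrow> 0 \<le> G j"
    and bary: "\<kappa> (l - 1) < (\<Sum>j=1..M. \<kappa> j * (p j * (1 + G j * (t * k_tilde M i k j)))) /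
        (\<Sum>j=1..M. p j * (1 + G j * (t * k_tilde M i k j)))"
      "(\<Sum>j=1..M. \<kappa> j * (p j * (1 + G j * (t * k_tilde M i k j)))) /
        (\<Sum>j=1..M. p j * (1 + G j * (t * k_tilde M i k j))) \<le> \<kappa> l"
    and eq: "\<And>j. j \<in> {1..M} \<Longrightarrow> G j = d j *
      (if j \<le> l - 1 then \<Sum>a=1..j-1. (\<kappa> j - \<kappa> a) * p a * (1 + G a * (t * k_tilde M i k a))
       else \<Sum>a=j+1..M. (\<kappa> a - \<kappa> j) * p a * (1 + G a * (t * k_tilde M i k a)))"
    using assms(1) by (auto intro: coupled_recursion_solvable[OF _ mono p d q])
  have comm: "G j * (t * r) = t * G j * r" for j r by simp
  have "G j = 1 / (t * p j) * c j *
      (if j \<le> l - 1 then \<Sum>a=1..j-1. (\<kappa> j - \<kappa> a) * p a * (1 + t * G a * k_tilde M i k a)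
       else \<Sum>a=j+1..M. (\<kappa> a - \<kappa> j) * p a * (1 + t * G a * k_tilde M i k a))"
    if "j \<in> {2..M-1}" for j
  proof -
    have "j \<in> {1..M}" "d j = 1 / (t * p j) * c j" using that by (auto simp: d_def)
    then show ?thesis using eq[of j] unfolding comm by simp
  qed
  moreover have "\<forall>j\<in>{2..M-1}. G j \<ge> 0" using G(4) by auto
  ultimately show ?thesis
    using G(1-3) bary unfolding comm c_def mult.assoc[symmetric, of "\<kappa> _" "p _"]
    by (intro exI[of _ G] conjI bexI[of _ l] ballI; blast)
qed

end
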